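(* Let $n\ge 1$, let $\Phi$ be the root system of type $A_n$, and let $F: X_{n+1}\times X_{n+1}\to X_{n+1}$ be a binary operation on $X_{n+1}=\{1,\dots,n+1\}$ such that $F(a,b)\in\{a,b\}$ for all $a,b\in X_{n+1}$. Let $C\subset\Phi$ be the set determined by the following rules, for all $1\le j\le k\le n$: (1) $\{\alpha_{j,k+1},-\alpha_{j,k+1}\}\cap C=\emptyset$ if and only if $F(j,k+1)=j$ and $F(k+1,j)=k+1$; (2) $\alpha_{j,k+1}\in C$ and $-\alpha_{j,k+1}\notin C$ if and only if $F(j,k+1)=F(k+1,j)=k+1$; (3) $-\alpha_{j,k+1}\in C$ and $\alpha_{j,k+1}\notin C$ if and only if $F(j,k+1)=F(k+1,j)=j$; (4) $\{\alpha_{j,k+1},-\alpha_{j,k+1}\}\subset C$ if and only if $F(j,k+1)=k+1$ and $F(k+1,j)=j$. Then $C$ is biclosed in $\Phi$ if and only if $F$ is associative.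
   Context: Root system of type $A_n$: $V$ is a real vector space with basis $\alpha_1,\dots,\alpha_n$ and $\Phi=\{\pm(\alpha_i+\cdots+\alpha_k):1\le i\le k\le n\}$. For $1\le j\le k\le n$, $\alpha_{j,k+1}:=\alpha_j+\alpha_{j+1}+\cdots+\alpha_k$. A subset $C\subset\Phi$ is closed if $\alpha,\beta\in C$ and $\alpha+\beta\in\Phi$ imply $\alpha+\beta\in C$. It is biclosed in $\Phi$ if both $C$ and $\Phi\setminus C$ are closed. *)

theory Defs
  imports Complex_Main
begin

definition is_basis :: "'v::real_vector set \<Rightarrow> nat \<Rightarrow> (nat \<Rightarrow> 'v) \<Rightarrow> bool" where
  "is_basis V n \<alpha> \<longleftrightarrow>
     inj_on \<alpha> {1..n} \<and> independent (\<alpha> ` {1..n}) \<and> span (\<alpha> ` {1..n}) = V"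

text \<open>The sum runs over a half-open interval, so that \<open>pos_root \<alpha> j (k + 1)\<close> is
  \<open>\<alpha> j + \<dots> + \<alpha> k\<close>.\<close>

definition pos_root :: "(nat \<Rightarrow> 'v::real_vector) \<Rightarrow> nat \<Rightarrow> nat \<Rightarrow> 'v" where
  "pos_root \<alpha> j m = (\<Sum>i = j..<m. \<alpha> i)"

definition root_system_A :: "nat \<Rightarrow> (nat \<Rightarrow> 'v::real_vector) \<Rightarrow> 'v set" where
  "root_system_A n \<alpha> =
     {\<beta>. \<exists>i k. 1 \<le> i \<and> i \<le> k \<and> k \<le> n \<and>
        (\<beta> = (\<Sum>l = i..k. \<alpha> l) \<or> \<beta> = - (\<Sum>l = i..k. \<alpha> l))}"

definition closed_in_roots :: "'v::real_vector set \<Rightarrow> 'v set \<Rightarrow> bool" where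
  "closed_in_roots \<Phi> C \<longleftrightarrow>
     C \<subseteq> \<Phi> \<and> (\<forall>\<alpha>\<in>C. \<forall>\<beta>\<in>C. \<alpha> + \<beta> \<in> \<Phi> \<longrightarrow> \<alpha> + \<beta> \<in> C)"

definition biclosed_in_roots :: "'v::real_vector set \<Rightarrow> 'v set \<Rightarrow> bool" where
  "biclosed_in_roots \<Phi> C \<longleftrightarrow> closed_in_roots \<Phi> C \<and> closed_in_roots \<Phi> (\<Phi> - C)"

definition associative_on :: "'a set \<Rightarrow> ('a \<Rightarrow> 'a \<Rightarrow> 'a) \<Rightarrow> bool" where
  "associative_on X F \<longleftrightarrow> (\<forall>a\<in>X. \<forall>b\<in>X. \<forall>c\<in>X. F (F a b) c = F a (F b c))"

end

(* With S i = \<alpha> 1 + ... + \<alpha> (i - 1), the roots are the differences S j - S i for distinct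
   i, j in {1..n+1}, and the four rules say that S j - S i lies in C iff F i j = j. Since the S i
   are affinely independent, a sum of two roots is a root only if it telescopes, so biclosedness
   of C says that the relation F i j = j and its complement are both transitive on distinct triples.
   For a selective operation this is exactly associativity. *)
theory Submission
  imports Defs
begin

text \<open>The equivalence holds triple by triple. If two of \<open>a\<close>, \<open>b\<close>,
  \<open>c\<close> coincide, selectivity alone makes both bracketings agree. For distinct entries,
  \<open>F a b = b\<close> and \<open>F b c = c\<close> reduce associativity to
  \<open>c = F a c\<close>; \<open>F a b = a\<close> and \<open>F b c = b\<close> reduce it to
  \<open>F a c = a\<close>; in the two mixed cases both sides agree anyway.\<close>

lemma associative_on_selective_iff:
  assumes sel: "\<And>a b. a \<in> X \<Longrightarrow> b \<in> X \<Longrightarrow> F a b \<in> {a, b}"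
  shows "associative_on X F \<longleftrightarrow>
    (\<forall>a\<in>X. \<forall>b\<in>X. \<forall>c\<in>X. a \<noteq> b \<longrightarrow> b \<noteq> c \<longrightarrow> a \<noteq> c \<longrightarrow>
       (F a b = b \<longrightarrow> F b c = c \<longrightarrow> F a c = c) \<and>
       (F a b \<noteq> b \<longrightarrow> F b c \<noteq> c \<longrightarrow> F a c \<noteq> c))"
    (is "_ \<longleftrightarrow> (\<forall>a\<in>X. \<forall>b\<in>X. \<forall>c\<in>X. ?P a b c)")
proof -
  have "F (F a b) c = F a (F b c) \<longleftrightarrow> ?P a b c" if "a \<in> X" "b \<in> X" "c \<in> X" for a b c
    using sel[of a a] sel[of a b] sel[of b a] sel[of b b] sel[of a c] sel[of c a]
      sel[of b c] sel[of c b] that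
    by (cases "F a b = b"; cases "F b c = c"; cases "a = b"; cases "b = c"; cases "a = c") auto
  then show ?thesis
    unfolding associative_on_def by blast
qed

lemma pos_root_eq_diff:
  assumes "1 \<le> j" "j \<le> m"
  shows "pos_root \<alpha> j m = pos_root \<alpha> 1 m - pos_root \<alpha> 1 j"
  using sum.atLeastLessThan_concat[OF assms, of \<alpha>] unfolding pos_root_def
  by (simp add: algebra_simps)

text \<open>The sign of a root becomes the order of a pair of indices, so that closedness can be
  treated later without splitting on signs. The block from \<open>i\<close> to \<open>k\<close>
  corresponds to the pair \<open>i\<close>, \<open>k+1\<close>.\<close>

lemma root_system_A_eq:
  "root_system_A n \<alpha> =
     {pos_root \<alpha> 1 j - pos_root \<alpha> 1 i | i j. i \<in> {1..n+1} \<and> j \<in> {1..n+1} \<and> i \<noteq> j}"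
    (is "_ = ?R")
proof (intro set_eqI iffI)
  fix \<beta> assume "\<beta> \<in> root_system_A n \<alpha>"
  then obtain i k where ik: "1 \<le> i" "i \<le> k" "k \<le> n"
    and "\<beta> = (\<Sum>l = i..k. \<alpha> l) \<or> \<beta> = - (\<Sum>l = i..k. \<alpha> l)"
    unfolding root_system_A_def by blast
  moreover have "(\<Sum>l = i..k. \<alpha> l) = pos_root \<alpha> 1 (k+1) - pos_root \<alpha> 1 i"
    using pos_root_eq_diff[of i "k+1" \<alpha>] ik
    by (simp add: pos_root_def atLeastLessThanSuc_atLeastAtMost)
  ultimately have "\<beta> = pos_root \<alpha> 1 (k+1) - pos_root \<alpha> 1 i \<or>
      \<beta> = pos_root \<alpha> 1 i - pos_root \<alpha> 1 (k+1)"
    by auto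
  moreover have "i \<in> {1..n+1}" "k+1 \<in> {1..n+1}" "i \<noteq> k+1" "k+1 \<noteq> i"
    using ik by auto
  ultimately show "\<beta> \<in> ?R"
    by blast
next
  fix \<beta> assume "\<beta> \<in> ?R"
  then obtain i j where ij: "i \<in> {1..n+1}" "j \<in> {1..n+1}" "i \<noteq> j"
    and \<beta>: "\<beta> = pos_root \<alpha> 1 j - pos_root \<alpha> 1 i"
    by blast
  have pos: "pos_root \<alpha> 1 b - pos_root \<alpha> 1 a = (\<Sum>l = a..b - 1. \<alpha> l)" if "1 \<le> a" "a < b" for a b
  proof -
    have "{a..<b} = {a..b - 1}"
      using that by auto
    then show ?thesis
      using pos_root_eq_diff[of a b \<alpha>] that by (simp add: pos_root_def)
  qed
  show "\<beta> \<in> root_system_A n \<alpha>"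
  proof (cases "i < j")
    case True
    then have "\<beta> = (\<Sum>l = i..j - 1. \<alpha> l)" "1 \<le> i" "i \<le> j - 1" "j - 1 \<le> n"
      using ij \<beta> pos[of i j] by auto
    then show ?thesis
      unfolding root_system_A_def by blast
  next
    case False
    then have "\<beta> = - (\<Sum>l = j..i - 1. \<alpha> l)" "1 \<le> j" "j \<le> i - 1" "i - 1 \<le> n"
      using ij \<beta> pos[of j i, symmetric] by auto
    then show ?thesis
      unfolding root_system_A_def by blast
  qed
qed

text \<open>This is affine independence of the partial sums in dual form: a functional takes
  prescribed values on them up to a constant. Setting its value at \<alpha> \<open>l\<close> to
  \<open>f (l+1) - f l\<close> makes the sum telescope; the constant \<open>f 1\<close> appears
  because the first partial sum is empty.\<close>

lemma linear_on_partial_sums: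
  fixes \<alpha> :: "nat \<Rightarrow> 'v::real_vector" and f :: "nat \<Rightarrow> real"
  assumes basis: "inj_on \<alpha> {1..n}" "independent (\<alpha> ` {1..n})"
  obtains L :: "'v \<Rightarrow> real" where "linear L"
    "\<And>i. i \<in> {1..n+1} \<Longrightarrow> L (pos_root \<alpha> 1 i) = f i - f 1"
proof -
  \<comment> \<open>Injectivity on the index set lets \<open>inv_into\<close> recover the index of a
    basis vector.\<close>
  obtain L :: "'v \<Rightarrow> real" where L: "linear L"
    and L_basis: "\<And>x. x \<in> \<alpha> ` {1..n} \<Longrightarrow>
      L x = f (inv_into {1..n} \<alpha> x + 1) - f (inv_into {1..n} \<alpha> x)"
    using linear_independent_extend[OF basis(2),
        of "\<lambda>x. f (inv_into {1..n} \<alpha> x + 1) - f (inv_into {1..n} \<alpha> x)"]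
    by blast
  have "L (pos_root \<alpha> 1 i) = f i - f 1" if "i \<in> {1..n+1}" for i
  proof -
    have L_\<alpha>: "L (\<alpha> l) = f (Suc l) - f l" if "l \<in> {1..<i}" for l
    proof -
      have "l \<in> {1..n}"
        using that \<open>i \<in> {1..n+1}\<close> by auto
      then show ?thesis
        using L_basis[of "\<alpha> l"] inv_into_f_f[OF basis(1), of l] by simp
    qed
    have "L (pos_root \<alpha> 1 i) = (\<Sum>l = 1..<i. L (\<alpha> l))"
      unfolding pos_root_def by (rule linear_sum[OF L])
    also have "\<dots> = (\<Sum>l = 1..<i. f (Suc l) - f l)"
      by (rule sum.cong) (simp_all add: L_\<alpha>)
    also have "\<dots> = f i - f 1"
      using that by (intro sum_Suc_diff') auto
    finally show ?thesis .
  qed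
  with L show thesis by (rule that)
qed

lemma root_add_root_cases:
  fixes \<alpha> :: "nat \<Rightarrow> 'v::real_vector"
  defines "S \<equiv> pos_root \<alpha> 1"
  assumes basis: "inj_on \<alpha> {1..n}" "independent (\<alpha> ` {1..n})"
    and X: "i \<in> {1..n+1}" "j \<in> {1..n+1}" "k \<in> {1..n+1}" "l \<in> {1..n+1}"
      "p \<in> {1..n+1}" "q \<in> {1..n+1}"
    and neq: "i \<noteq> j" "k \<noteq> l" "p \<noteq> q"
    and eq: "(S j - S i) + (S l - S k) = S q - S p"
  shows "(j = k \<and> p = i \<and> q = l) \<or> (l = i \<and> p = k \<and> q = j)"
proof -
  \<comment> \<open>Choosing the indicator of \<open>t\<close> as \<open>f\<close> compares the
    coefficients of \<open>S t\<close> on both sides; the constant \<open>of_bool (1 = t)\<close>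
    cancels in every difference.\<close>
  have ind: "(of_bool (j = t) - of_bool (i = t)) + (of_bool (l = t) - of_bool (k = t))
      = (of_bool (q = t) - of_bool (p = t) :: real)" for t
  proof -
    obtain L :: "'v \<Rightarrow> real" where L: "linear L"
      and L_S: "\<And>i. i \<in> {1..n+1} \<Longrightarrow> L (S i) = of_bool (i = t) - of_bool (1 = t)"
      using linear_on_partial_sums[OF basis, of "\<lambda>i. of_bool (i = t)"] unfolding S_def by blast
    have "(L (S j) - L (S i)) + (L (S l) - L (S k)) = L (S q) - L (S p)"
      using arg_cong[OF eq, of L] by (simp add: linear_add[OF L] linear_diff[OF L])
    then show ?thesis
      unfolding L_S[OF X(1)] L_S[OF X(2)] L_S[OF X(3)] L_S[OF X(4)] L_S[OF X(5)] L_S[OF X(6)]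
      by linarith
  qed
  show ?thesis
  proof (cases "j = k")
    case True
    then have ind': "of_bool (l = t) - of_bool (i = t) = (of_bool (q = t) - of_bool (p = t) :: real)" for t
      using ind[of t] by simp
    \<comment> \<open>At \<open>t = p\<close> the right side is -1, which forces
      \<open>i = p\<close>; at \<open>t = q\<close> it is 1, which forces
      \<open>l = q\<close>.\<close>
    have "p = i" "q = l"
      using ind'[of p] ind'[of q] neq by (auto simp: of_bool_def split: if_splits)
    with True show ?thesis
      by simp
  next
    case False
    \<comment> \<open>Nothing cancels the coefficient of \<open>S j\<close>, since \<open>i\<close>
      and \<open>k\<close> both differ from \<open>j\<close>; hence it must come from
      \<open>S q\<close>.\<close>
    then have "q = j"
      using ind[of j] neq by (auto simp: of_bool_def split: if_splits)
    then have ind': "of_bool (l = t) + of_bool (p = t) = (of_bool (i = t) + of_bool (k = t) :: real)" for t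
      using ind[of t] by simp
    have "l = i"
      using ind'[of l] neq by (auto simp: of_bool_def split: if_splits)
    moreover have "p = k"
      using ind'[of k] neq by (auto simp: of_bool_def split: if_splits)
    ultimately show ?thesis
      using \<open>q = j\<close> by simp
  qed
qed

text \<open>Stated for an arbitrary set \<open>D\<close> of roots, so that it serves both
  \<open>C\<close> and its complement.\<close>

lemma closed_in_root_system_A_iff:
  fixes \<alpha> :: "nat \<Rightarrow> 'v::real_vector"
  defines "S \<equiv> pos_root \<alpha> 1"
  assumes basis: "inj_on \<alpha> {1..n}" "independent (\<alpha> ` {1..n})"
    and sub: "D \<subseteq> root_system_A n \<alpha>"
  shows "closed_in_roots (root_system_A n \<alpha>) D \<longleftrightarrow>
    (\<forall>a\<in>{1..n+1}. \<forall>b\<in>{1..n+1}. \<forall>c\<in>{1..n+1}. a \<noteq> b \<longrightarrow> b \<noteq> c \<longrightarrow> a \<noteq> c \<longrightarrow>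
       S b - S a \<in> D \<longrightarrow> S c - S b \<in> D \<longrightarrow> S c - S a \<in> D)"
    (is "?closed \<longleftrightarrow> ?trans")
proof
  assume closed: ?closed
  show ?trans
  proof (intro ballI impI)
    fix a b c assume "a \<in> {1..n+1}" "c \<in> {1..n+1}" "a \<noteq> c"
    then have "S c - S a \<in> root_system_A n \<alpha>"
      unfolding root_system_A_eq S_def by blast
    moreover assume "S b - S a \<in> D" "S c - S b \<in> D"
    moreover have "(S b - S a) + (S c - S b) = S c - S a"
      by simp
    ultimately show "S c - S a \<in> D"
      using closed unfolding closed_in_roots_def by metis
  qed
next
  assume trans: ?trans
  have "\<beta> + \<gamma> \<in> D" if \<beta>: "\<beta> \<in> D" and \<gamma>: "\<gamma> \<in> D" and sum: "\<beta> + \<gamma> \<in> root_system_A n \<alpha>" for \<beta> \<gamma>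
  proof -
    obtain i j where ij: "i \<in> {1..n+1}" "j \<in> {1..n+1}" "i \<noteq> j" "\<beta> = S j - S i"
      using \<beta> sub unfolding root_system_A_eq S_def by blast
    obtain k l where kl: "k \<in> {1..n+1}" "l \<in> {1..n+1}" "k \<noteq> l" "\<gamma> = S l - S k"
      using \<gamma> sub unfolding root_system_A_eq S_def by blast
    obtain p q where pq: "p \<in> {1..n+1}" "q \<in> {1..n+1}" "p \<noteq> q" "\<beta> + \<gamma> = S q - S p"
      using sum unfolding root_system_A_eq S_def by blast
    have "(j = k \<and> p = i \<and> q = l) \<or> (l = i \<and> p = k \<and> q = j)"
      using root_add_root_cases[OF basis, of i j k l p q] ij kl pq unfolding S_def by simp
    \<comment> \<open>The second case is the first with the summands exchanged. The condition
      \<open>a \<noteq> c\<close> of the transitivity hypothesis comes from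
      \<open>p \<noteq> q\<close>.\<close>
    then show ?thesis
      using trans \<beta> \<gamma> ij kl pq by metis
  qed
  with sub show ?closed
    unfolding closed_in_roots_def by blast
qed

theorem theorem3p7:
  fixes n :: nat
    and V :: "'v::real_vector set"
    and \<alpha> :: "nat \<Rightarrow> 'v"
    and F :: "nat \<Rightarrow> nat \<Rightarrow> nat"
    and \<Phi> C :: "'v set"
  assumes "n \<ge> 1"
    and "is_basis V n \<alpha>"
    and "\<Phi> = root_system_A n \<alpha>"
    and "\<And>a b. a \<in> {1..n+1} \<Longrightarrow> b \<in> {1..n+1} \<Longrightarrow> F a b \<in> {a, b}"
    and "C \<subseteq> \<Phi>"
    and "\<And>j k. 1 \<le> j \<Longrightarrow> j \<le> k \<Longrightarrow> k \<le> n \<Longrightarrow>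
           {pos_root \<alpha> j (k+1), - pos_root \<alpha> j (k+1)} \<inter> C = {} \<longleftrightarrow>
           F j (k+1) = j \<and> F (k+1) j = k+1"
    and "\<And>j k. 1 \<le> j \<Longrightarrow> j \<le> k \<Longrightarrow> k \<le> n \<Longrightarrow>
           pos_root \<alpha> j (k+1) \<in> C \<and> - pos_root \<alpha> j (k+1) \<notin> C \<longleftrightarrow>
           F j (k+1) = k+1 \<and> F (k+1) j = k+1"
    and "\<And>j k. 1 \<le> j \<Longrightarrow> j \<le> k \<Longrightarrow> k \<le> n \<Longrightarrow>
           - pos_root \<alpha> j (k+1) \<in> C \<and> pos_root \<alpha> j (k+1) \<notin> C \<longleftrightarrow>
           F j (k+1) = j \<and> F (k+1) j = j"
    and "\<And>j k. 1 \<le> j \<Longrightarrow> j \<le> k \<Longrightarrow> k \<le> n \<Longrightarrow>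
           {pos_root \<alpha> j (k+1), - pos_root \<alpha> j (k+1)} \<subseteq> C \<longleftrightarrow>
           F j (k+1) = k+1 \<and> F (k+1) j = j"
  shows "biclosed_in_roots \<Phi> C \<longleftrightarrow> associative_on {1..n+1} F"
proof -
  define S where "S = pos_root \<alpha> 1"
  let ?X = "{1..n+1}"
  note \<Phi> = assms(3) and sel = assms(4) and sub = assms(5)
  have basis: "inj_on \<alpha> {1..n}" "independent (\<alpha> ` {1..n})"
    using assms(2) unfolding is_basis_def by auto
  have pair: "(S m - S j \<in> C \<longleftrightarrow> F j m = m) \<and> (S j - S m \<in> C \<longleftrightarrow> F m j = j)"
    if "j \<in> ?X" "m \<in> ?X" "j < m" for j m
  proof -
    \<comment> \<open>The rules are used with \<open>k = m - 1\<close>; \<open>j < m\<close> ensures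
      that the subtraction does not truncate.\<close>
    have jk: "1 \<le> j" "j \<le> m - 1" "m - 1 \<le> n" and m: "m - 1 + 1 = m"
      using that by auto
    have "pos_root \<alpha> j m = S m - S j" "- pos_root \<alpha> j m = S j - S m"
      unfolding S_def using pos_root_eq_diff[of j m \<alpha>] that by auto
    note rules = assms(6-9)[OF jk, unfolded m this]
    \<comment> \<open>By selectivity and \<open>j < m\<close>, the pair \<open>F j m\<close>,
      \<open>F m j\<close> takes one of four value patterns, and each rule matches one of them to a
      membership pattern of the two opposite roots.\<close>
    show ?thesis
      using rules sel[OF that(1,2)] sel[OF that(2,1)] that(3) by auto
  qed
  have C_iff: "S b - S a \<in> C \<longleftrightarrow> F a b = b" if "a \<in> ?X" "b \<in> ?X" "a \<noteq> b" for a b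
    using pair[of a b] pair[of b a] that by (cases "a < b") auto
  have compl_iff: "S b - S a \<in> \<Phi> - C \<longleftrightarrow> F a b \<noteq> b" if "a \<in> ?X" "b \<in> ?X" "a \<noteq> b" for a b
  proof -
    have "S b - S a \<in> \<Phi>"
      unfolding \<Phi> root_system_A_eq S_def using that by blast
    then show ?thesis
      using C_iff[OF that] by simp
  qed
  have "closed_in_roots \<Phi> C \<longleftrightarrow>
      (\<forall>a\<in>?X. \<forall>b\<in>?X. \<forall>c\<in>?X. a \<noteq> b \<longrightarrow> b \<noteq> c \<longrightarrow> a \<noteq> c \<longrightarrow>
         F a b = b \<longrightarrow> F b c = c \<longrightarrow> F a c = c)"
    using closed_in_root_system_A_iff[OF basis, folded S_def \<Phi>, OF sub]
    \<comment> \<open>The congruence rules supply the premises of \<open>C_iff\<close> from the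
      bounds and the distinctness conditions; deleting \<open>atLeastAtMost_iff\<close> keeps the
      membership facts in matching form.\<close>
    by (simp add: C_iff cong: ball_cong imp_cong del: atLeastAtMost_iff)
  moreover have "closed_in_roots \<Phi> (\<Phi> - C) \<longleftrightarrow>
      (\<forall>a\<in>?X. \<forall>b\<in>?X. \<forall>c\<in>?X. a \<noteq> b \<longrightarrow> b \<noteq> c \<longrightarrow> a \<noteq> c \<longrightarrow>
         F a b \<noteq> b \<longrightarrow> F b c \<noteq> c \<longrightarrow> F a c \<noteq> c)"
    using closed_in_root_system_A_iff[OF basis, folded S_def \<Phi>, OF Diff_subset]
    \<comment> \<open>\<open>Diff_iff\<close> is deleted as well, so that \<open>compl_iff\<close>
      can rewrite membership in the complement as a whole.\<close>
    by (simp add: compl_iff cong: ball_cong imp_cong del: atLeastAtMost_iff Diff_iff)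
  ultimately show ?thesis
    by (simp only: biclosed_in_roots_def associative_on_selective_iff[of ?X F, OF sel]
        imp_conjR ball_conj_distrib)
qed

end
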